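(* Let $N>1$ be an integer, let $\chi$ be a primitive Dirichlet character modulo $N$, and let $1/2<s<1$. Define \[ m_{s,\chi}(x)=\sum_{n=1}^{\infty}\frac{\chi(n)\,e^{-2\pi i n^2 x}}{n^s},\qquad x\in[0,1]. \] Then $m_{s,\chi}$ belongs to weak-type $L^{2/(1-s)}[0,1]$; that is, there is a constant $c$ such that $|\{x\in[0,1]: |m_{s,\chi}(x)|>\alpha\}|\le c\,\alpha^{-2/(1-s)}$ for all $\alpha>0$.
   Context: Since $s>1/2$, the coefficients $\chi(n)n^{-s}$ are square-summable, so the series defining $m_{s,\chi}$ converges in $L^2[0,1]$ and defines a function in $L^2[0,1]$. For $r>0$, a function $g$ on $[0,1]$ is of weak-type $L^r[0,1]$ if $|\{x\in[0,1]: |g(x)|>\alpha\}|\le c\,\alpha^{-r}$ for all $\alpha>0$, with $c$ independent of $\alpha$; $|\cdot|$ denotes Lebesgue measure. *)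

theory Defs
  imports "HOL-Analysis.Analysis"
begin

definition dirichlet_character :: "nat \<Rightarrow> (nat \<Rightarrow> complex) \<Rightarrow> bool" where
  "dirichlet_character N chi \<longleftrightarrow>
     N > 0 \<and> chi 1 = 1 \<and>
     (\<forall>m n. chi (m * n) = chi m * chi n) \<and>
     (\<forall>n. chi (n + N) = chi n) \<and>
     (\<forall>n. chi n = 0 \<longleftrightarrow> \<not> coprime n N)"

text \<open>Primitive: not induced by a character of any modulus d properly dividing N,
  i.e. for no proper divisor d of N is chi constant on the classes mod d of the
  units mod N.\<close>
definition primitive_character :: "nat \<Rightarrow> (nat \<Rightarrow> complex) \<Rightarrow> bool" where
  "primitive_character N chi \<longleftrightarrow>
     dirichlet_character N chi \<and>
     (\<forall>d. d dvd N \<and> d < N \<longrightarrow>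
        \<not> (\<forall>a b. coprime a N \<and> coprime b N \<and> a mod d = b mod d \<longrightarrow> chi a = chi b))"

definition m_partial :: "real \<Rightarrow> (nat \<Rightarrow> complex) \<Rightarrow> nat \<Rightarrow> real \<Rightarrow> complex" where
  "m_partial s chi K x =
     (\<Sum>n=1..K. chi n * exp (- 2 * pi * \<i> * of_nat (n^2) * of_real x) / of_real (real n powr s))"

end

theory Submission
  imports Defs
begin

text \<open>
  Split the series into dyadic blocks and into residue classes
  \<open>n = N * k + r\<close> with \<open>K \<le> k < 2 * K\<close>. Weyl differencing bounds the square of such a block by
  \<open>K powr (- 2 * s)\<close> times \<open>K + 2 * (\<Sum>h\<le>K. min K (1 / \<parallel>h * y\<parallel>))\<close>, where \<open>y = 2 * N\<^sup>2 * x\<close> and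
  \<open>\<parallel>\<cdot>\<parallel>\<close> is the distance to the nearest integer. If \<open>a / q\<close> is a Dirichlet approximation of \<open>y\<close> with
  \<open>q \<le> 2 * K\<close>, the \<open>h\<close> not divisible by \<open>q\<close> contribute \<open>O(K * ln K)\<close>, and the multiples of \<open>q\<close>
  contribute at most both \<open>K\<^sup>2 / q\<close> and \<open>4 * sqrt K / q * \<bar>y - a / q\<bar> powr (- 3/4)\<close>. Summing the lengths of
  the resulting arcs shows that an unweighted block of length \<open>K\<close> exceeds \<open>\<tau>\<close> on a set of measure
  \<open>O(K\<^sup>2 / \<tau>^4)\<close>, as soon as \<open>\<tau>\<^sup>2\<close> is at least a large multiple of \<open>K * ln K\<close>.

  Given a level \<open>\<alpha>\<close>, let \<open>2 ^ J\<close> be of order \<open>\<alpha> powr (1 / (1 - s))\<close>. The terms with \<open>n < N * 2 ^ J\<close> are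
  \<open>O(\<alpha>)\<close> trivially. For the blocks \<open>K = 2 ^ j\<close> with \<open>j \<ge> J\<close>, the measure bound at thresholds decaying
  geometrically in \<open>j - J\<close> sums to \<open>O(4 powr (- J))\<close>, which is \<open>O(\<alpha> powr (- 2 / (1 - s)))\<close>; here
  \<open>s > 1/2\<close> is used.
\<close>

section \<open>Weyl differencing\<close>

text \<open>Comparison with the integral of \<open>x powr (- \<beta>)\<close> by telescoping: the
  mean value theorem bounds each term by an increment of the antiderivative. It is used with
  \<open>\<beta>\<close> equal to \<open>3/4\<close>, \<open>1/3\<close> and
  \<open>s\<close>.\<close>

lemma sum_powr_neg_le:
  fixes \<beta> :: real
  assumes "0 < \<beta>" "\<beta> < 1"
  shows "(\<Sum>j=1..n. real j powr (- \<beta>)) \<le> real n powr (1 - \<beta>) / (1 - \<beta>)"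
proof (induction n)
  case 0
  then show ?case by simp
next
  case (Suc n)
  have step: "(1 - \<beta>) * real (Suc n) powr (- \<beta>) \<le> real (Suc n) powr (1 - \<beta>) - real n powr (1 - \<beta>)"
  proof (cases "n = 0")
    case True
    then show ?thesis using assms by simp
  next
    case False
    have "\<exists>z. real n < z \<and> z < real (Suc n) \<and>
        real (Suc n) powr (1 - \<beta>) - real n powr (1 - \<beta>)
          = (real (Suc n) - real n) * ((1 - \<beta>) * z powr (- \<beta>))"
    proof (rule MVT2)
      show "((\<lambda>x. x powr (1 - \<beta>)) has_real_derivative (1 - \<beta>) * x powr (- \<beta>)) (at x)"
        if "real n \<le> x" "x \<le> real (Suc n)" for x
        using that False by (auto intro!: derivative_eq_intros)
    qed simp
    then obtain z where z: "real n < z" "z < real (Suc n)"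
      "real (Suc n) powr (1 - \<beta>) - real n powr (1 - \<beta>) = (1 - \<beta>) * z powr (- \<beta>)" by auto
    have "real (Suc n) powr (- \<beta>) \<le> z powr (- \<beta>)"
      using z False assms by (intro powr_mono2') auto
    then show ?thesis using z(3) assms by simp
  qed
  have "(\<Sum>j=1..Suc n. real j powr (- \<beta>))
      \<le> real n powr (1 - \<beta>) / (1 - \<beta>) + real (Suc n) powr (- \<beta>)"
    using Suc by simp
  also have "\<dots> \<le> real (Suc n) powr (1 - \<beta>) / (1 - \<beta>)"
  proof -
    have "real (Suc n) powr (- \<beta>) \<le> (real (Suc n) powr (1 - \<beta>) - real n powr (1 - \<beta>)) / (1 - \<beta>)"
      using step assms by (simp only: pos_le_divide_eq) (simp add: mult.commute)
    then show ?thesis by (simp add: diff_divide_distrib)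
  qed
  finally show ?case .
qed

lemma harm_le_ln: "n > 0 \<Longrightarrow> (harm n :: real) \<le> 1 + ln (real n)"
proof (induction n rule: nat_induct_non_zero)
  case 1
  then show ?case by (simp add: harm_def)
next
  case (Suc n)
  have "ln (real n / real (Suc n)) \<le> real n / real (Suc n) - 1"
    using Suc.hyps by (intro ln_le_minus_one) simp
  then have "inverse (real (Suc n)) \<le> ln (real (Suc n)) - ln (real n)"
    using Suc.hyps by (simp add: ln_div field_simps)
  with Suc.IH show ?case by (simp add: harm_Suc)
qed

section \<open>Distance to the nearest integer and geometric sums\<close>

definition int_dist :: "real \<Rightarrow> real" where
  "int_dist u = \<bar>u - of_int (round u)\<bar>"

lemma int_dist_nonneg [simp]: "0 \<le> int_dist u"
  by (simp add: int_dist_def)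

lemma int_dist_le: "int_dist u \<le> \<bar>u - of_int k\<bar>"
  unfolding int_dist_def by (rule round_diff_minimal)

lemma int_dist_add_ge: "int_dist u - \<bar>v\<bar> \<le> int_dist (u + v)"
  using int_dist_le[of u "round (u + v)"] by (simp add: int_dist_def)

lemma int_dist_add_int: "int_dist (u + of_int k) = int_dist u"
proof (rule antisym)
  show "int_dist (u + of_int k) \<le> int_dist u"
    using int_dist_le[of "u + of_int k" "round u + k"] by (simp add: int_dist_def)
  show "int_dist u \<le> int_dist (u + of_int k)"
    using int_dist_le[of u "round (u + of_int k) - k"] by (simp add: int_dist_def algebra_simps)
qed

lemma int_dist_minus: "int_dist (- u) = int_dist u"
  using int_dist_le[of "- u" "- round u"] int_dist_le[of u "- round (- u)"]
  by (simp add: int_dist_def)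

lemma int_dist_eq_abs:
  assumes "\<bar>v\<bar> < 1/2"
  shows "int_dist v = \<bar>v\<bar>"
proof -
  have "round v = 0" using assms by (intro round_unique') simp
  then show ?thesis by (simp add: int_dist_def)
qed

text \<open>The Taylor remainder is at most \<open>x ^ 3 / 6\<close>, and
  \<open>x \<le> pi / 2 < 2\<close> makes this at most two thirds of \<open>x\<close>. This weak
  form of Jordan's inequality is enough below because \<open>pi / 3 > 1\<close>.\<close>

lemma sin_ge_third:
  fixes x :: real
  assumes "0 \<le> x" "x \<le> pi / 2"
  shows "x / 3 \<le> sin x"
proof -
  have "\<bar>sin x - (\<Sum>m<3. sin_coeff m * x ^ m)\<bar> \<le> inverse (fact 3) * \<bar>x\<bar> ^ 3"
    by (rule Maclaurin_sin_bound)
  then have "\<bar>sin x - x\<bar> \<le> x ^ 3 / 6"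
    using assms by (simp add: sin_coeff_def eval_nat_numeral)
  then have "x - x ^ 3 / 6 \<le> sin x" by linarith
  moreover have "x\<^sup>2 \<le> 2\<^sup>2"
    using assms pi_less_4 by (intro power_mono) auto
  then have "x * x\<^sup>2 \<le> x * 4" using assms by (intro mult_left_mono) auto
  ultimately show ?thesis by (simp add: power2_eq_square power3_eq_cube)
qed

lemma cmod_cis_minus_one_ge: "2 * int_dist u \<le> cmod (cis (2 * pi * u) - 1)"
proof -
  define v where "v = u - of_int (round u)"
  have v: "\<bar>v\<bar> \<le> 1/2" using of_int_round_abs_le[of u] by (simp add: v_def abs_minus_commute)
  have "cis (2 * pi * u) = cis (2 * pi * v) * cis (2 * pi * of_int (round u))"
    by (simp add: cis_mult v_def algebra_simps)
  also have "cis (2 * pi * of_int (round u)) = 1" by (intro cis_multiple_2pi) auto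
  finally have "cmod (cis (2 * pi * u) - 1) = 2 * \<bar>sin (pi * v)\<bar>"
    using dist_exp_i_1[of "2 * pi * v"] by (simp add: cis_conv_exp)
  moreover have "\<bar>sin (pi * v)\<bar> = \<bar>sin (pi * \<bar>v\<bar>)\<bar>" by (cases "v \<ge> 0") auto
  moreover have "pi * \<bar>v\<bar> / 3 \<le> sin (pi * \<bar>v\<bar>)" using v by (intro sin_ge_third) auto
  moreover have "3 * \<bar>v\<bar> \<le> pi * \<bar>v\<bar>" using pi_gt3 by (intro mult_right_mono) auto
  ultimately show ?thesis by (simp add: int_dist_def v_def[symmetric])
qed

text \<open>This is \<open>min K (1 / int_dist u)\<close> with the value \<open>K\<close> at integers \<open>u\<close>, where
  \<open>1 / int_dist u\<close> would be \<open>0\<close>.\<close>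

definition geom_bound :: "nat \<Rightarrow> real \<Rightarrow> real" where
  "geom_bound K u = (if int_dist u * K \<le> 1 then real K else 1 / int_dist u)"

lemma geom_bound_nonneg [simp]: "0 \<le> geom_bound K u"
  by (simp add: geom_bound_def)

lemma geom_bound_le: "geom_bound K u \<le> K"
proof (cases "int_dist u * K \<le> 1")
  case False
  then have "int_dist u > 0" by (metis int_dist_nonneg less_eq_real_def mult_zero_left zero_le_one)
  with False show ?thesis by (simp add: geom_bound_def field_simps)
qed (simp add: geom_bound_def)

lemma geom_bound_le_inverse: "int_dist u > 0 \<Longrightarrow> geom_bound K u \<le> 1 / int_dist u"
  by (simp add: geom_bound_def field_simps)

lemma geom_bound_minus: "geom_bound K (- u) = geom_bound K u"
  by (simp only: geom_bound_def int_dist_minus)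

text \<open>Trivial bound if \<open>u\<close> is within \<open>1 / K\<close> of an integer, closed
  form of the geometric sum otherwise. Allowing every \<open>m \<le> K\<close> provides the bound on
  all partial sums that Abel summation asks for.\<close>

lemma cmod_sum_cis_le:
  assumes "m \<le> K"
  shows "cmod (\<Sum>l<m. cis (2 * pi * u) ^ l) \<le> geom_bound K u"
proof (cases "int_dist u * K \<le> 1")
  case True
  have "cmod (\<Sum>l<m. cis (2 * pi * u) ^ l) \<le> (\<Sum>l<m. 1)"
    by (intro sum_norm_le) (simp add: norm_power)
  with True assms show ?thesis by (simp add: geom_bound_def)
next
  case False
  then have d: "int_dist u > 0" by (metis int_dist_nonneg less_eq_real_def mult_zero_left zero_le_one)
  let ?w = "cis (2 * pi * u)"
  have ge: "2 * int_dist u \<le> cmod (?w - 1)" by (rule cmod_cis_minus_one_ge)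
  with d have ne: "?w \<noteq> 1" by auto
  have "cmod (\<Sum>l<m. ?w ^ l) = cmod (?w ^ m - 1) / cmod (?w - 1)"
    using ne by (simp add: geometric_sum norm_divide)
  also have "\<dots> \<le> 2 / (2 * int_dist u)"
  proof (intro frac_le)
    show "cmod (?w ^ m - 1) \<le> 2"
      using norm_triangle_ineq4[of "?w ^ m" 1] by (simp add: norm_power)
  qed (use d ge in auto)
  finally show ?thesis using False by (simp add: geom_bound_def)
qed

text \<open>Abel summation: the weighted sum is a combination of the partial sums with the
  nonnegative coefficients \<open>b l - b (Suc l)\<close> and \<open>b n\<close>, whose total is
  \<open>b 0\<close>.\<close>

lemma norm_sum_decseq_le:
  fixes z :: "nat \<Rightarrow> complex" and b :: "nat \<Rightarrow> real"
  assumes b: "decseq b" "\<And>n. 0 \<le> b n" and G: "\<And>m. m \<le> n \<Longrightarrow> cmod (\<Sum>l<m. z l) \<le> G"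
  shows "cmod (\<Sum>l<n. of_real (b l) * z l) \<le> b 0 * G"
proof -
  let ?S = "\<lambda>m. \<Sum>l<m. z l"
  have eq: "(\<Sum>l<m. of_real (b l) * z l)
      = of_real (b m) * ?S m + (\<Sum>l<m. of_real (b l - b (Suc l)) * ?S (Suc l))" for m
    by (induction m) (auto simp: algebra_simps)
  have dec: "b (Suc l) \<le> b l" for l using b(1) by (simp add: decseq_Suc_iff)
  have "cmod (\<Sum>l<n. of_real (b l) * z l)
      \<le> b n * cmod (?S n) + (\<Sum>l<n. (b l - b (Suc l)) * cmod (?S (Suc l)))"
    unfolding eq
    by (rule norm_triangle_le, rule add_mono)
       (auto simp: norm_mult b dec simp del: sum.lessThan_Suc of_real_diff intro!: sum_norm_le)
  also have "\<dots> \<le> b n * G + (\<Sum>l<n. (b l - b (Suc l)) * G)"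
    by (intro add_mono sum_mono mult_left_mono G) (auto simp: b dec)
  also have "\<dots> = b n * G + (b 0 - b n) * G"
    by (simp only: sum_distrib_right[symmetric] sum_lessThan_telescope')
  also have "\<dots> = b 0 * G" by (simp add: algebra_simps)
  finally show ?thesis .
qed

text \<open>Expand the square and group the off-diagonal pairs by their distance \<open>h\<close>;
  exchanging the two members of a pair conjugates its product, whence the real part. The inner sum
  for \<open>h = K\<close> is empty.\<close>

lemma cmod_sum_power2:
  fixes z :: "nat \<Rightarrow> complex"
  shows "(cmod (\<Sum>k<K. z k))\<^sup>2 = (\<Sum>k<K. (cmod (z k))\<^sup>2)
      + 2 * Re (\<Sum>h=1..K. \<Sum>l<K-h. z (l + h) * cnj (z l))"
proof (induction K)
  case 0
  then show ?case by simp
next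
  case (Suc K)
  let ?S = "\<Sum>k<K. z k"
  have "(\<Sum>h=1..Suc K. \<Sum>l<Suc K-h. z (l + h) * cnj (z l))
      = (\<Sum>h=1..K. (\<Sum>l<K-h. z (l + h) * cnj (z l)) + z K * cnj (z (K - h)))"
    by (auto simp: Suc_diff_le intro!: sum.cong)
  also have "\<dots> = (\<Sum>h=1..K. \<Sum>l<K-h. z (l + h) * cnj (z l)) + z K * (\<Sum>h=1..K. cnj (z (K - h)))"
    by (simp add: sum.distrib sum_distrib_left)
  also have "(\<Sum>h=1..K. cnj (z (K - h))) = (\<Sum>k<K. cnj (z k))"
    by (rule sum.reindex_bij_witness[of _ "\<lambda>k. K - k" "\<lambda>h. K - h"]) auto
  finally have eq: "(\<Sum>h=1..Suc K. \<Sum>l<Suc K-h. z (l + h) * cnj (z l))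
      = (\<Sum>h=1..K. \<Sum>l<K-h. z (l + h) * cnj (z l)) + z K * cnj ?S" by simp
  have "(cmod (?S + z K))\<^sup>2 = (cmod ?S)\<^sup>2 + (cmod (z K))\<^sup>2 + 2 * Re (z K * cnj ?S)"
    unfolding cmod_power2 by (simp add: power2_eq_square sum_negf algebra_simps)
  with Suc show ?case unfolding eq by simp
qed

text \<open>For a fixed shift \<open>h\<close> the difference of the quadratic phases is linear in
  \<open>l\<close>, so the correlation is a geometric sum with frequency \<open>h * y\<close>; the
  factor 1/2 in the phase is there to make it exactly that. The products
  \<open>w (l + h) * w l\<close> decrease in \<open>l\<close>, and Abel summation removes
  them.\<close>

lemma weyl_differencing:
  fixes w :: "nat \<Rightarrow> real" and y \<beta> \<gamma> :: real
  assumes w: "decseq w" "\<And>n. 0 \<le> w n"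
  shows "(cmod (\<Sum>k<K. of_real (w k) * cis (2 * pi * (y * (real k)\<^sup>2 / 2 + \<beta> * k + \<gamma>))))\<^sup>2
    \<le> (w 0)\<^sup>2 * (K + 2 * (\<Sum>h=1..K. geom_bound K (real h * y)))"
proof -
  define \<theta> where "\<theta> k = 2 * pi * (y * (real k)\<^sup>2 / 2 + \<beta> * k + \<gamma>)" for k :: nat
  define z where "z k = of_real (w k) * cis (\<theta> k)" for k
  have w0: "w n \<le> w 0" for n using w(1) by (simp add: decseqD)
  have corr: "cmod (\<Sum>l<K-h. z (l + h) * cnj (z l)) \<le> (w 0)\<^sup>2 * geom_bound K (real h * y)" for h
  proof -
    define c where "c = cis (2 * pi * (y * (real h)\<^sup>2 / 2 + \<beta> * h))"
    have "z (l + h) * cnj (z l) = c * (of_real (w (l + h) * w l) * cis (2 * pi * (real h * y)) ^ l)" for l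
    proof -
      have "\<theta> (l + h) - \<theta> l = 2 * pi * (y * (real h)\<^sup>2 / 2 + \<beta> * h) + real l * (2 * pi * (real h * y))"
        by (simp add: \<theta>_def power2_eq_square field_simps)
      then have "cis (\<theta> (l + h)) * cis (- \<theta> l) = c * cis (2 * pi * (real h * y)) ^ l"
        by (simp add: c_def Complex.DeMoivre cis_mult)
      then show ?thesis by (simp add: z_def cis_cnj)
    qed
    then have "cmod (\<Sum>l<K-h. z (l + h) * cnj (z l))
        = cmod (\<Sum>l<K-h. of_real (w (l + h) * w l) * cis (2 * pi * (real h * y)) ^ l)"
      by (simp add: sum_distrib_left[symmetric] norm_mult c_def)
    also have "\<dots> \<le> (w (0 + h) * w 0) * geom_bound K (real h * y)"
    proof (rule norm_sum_decseq_le)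
      show "decseq (\<lambda>l. w (l + h) * w l)"
        unfolding decseq_def using w by (auto intro!: mult_mono simp: decseqD)
    qed (auto simp: w intro!: cmod_sum_cis_le)
    also have "\<dots> \<le> (w 0 * w 0) * geom_bound K (real h * y)"
      by (intro mult_right_mono) (auto simp: w w0)
    finally show ?thesis by (simp add: power2_eq_square)
  qed
  have "(cmod (\<Sum>k<K. z k))\<^sup>2 \<le> (\<Sum>k<K. (w 0)\<^sup>2)
      + 2 * (\<Sum>h=1..K. (w 0)\<^sup>2 * geom_bound K (real h * y))"
    unfolding cmod_sum_power2
  proof (intro add_mono mult_left_mono)
    show "(\<Sum>k<K. (cmod (z k))\<^sup>2) \<le> (\<Sum>k<K. (w 0)\<^sup>2)"
      by (intro sum_mono power_mono) (auto simp: z_def norm_mult w w0)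
    show "Re (\<Sum>h=1..K. \<Sum>l<K-h. z (l + h) * cnj (z l)) \<le> (\<Sum>h=1..K. (w 0)\<^sup>2 * geom_bound K (real h * y))"
      by (rule order_trans[OF complex_Re_le_cmod]) (intro sum_norm_le corr)
  qed simp
  then show ?thesis by (simp add: z_def \<theta>_def sum_distrib_left algebra_simps)
qed

section \<open>Sums over distances to the nearest integer\<close>

lemma int_dist_div_ge:
  assumes "0 < v" "v < q"
  shows "min (real v) (real q - real v) / real q \<le> int_dist (real v / real q)"
proof -
  define k where "k = round (real v / real q)"
  have "min (real v) (real q - real v) \<le> \<bar>real v - real q * of_int k\<bar>"
  proof (cases "k \<le> 0")
    case True
    then have "real q * of_int k \<le> 0" by (simp add: mult_nonneg_nonpos)
    then show ?thesis by linarith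
  next
    case False
    then have "real q * 1 \<le> real q * of_int k" by (intro mult_left_mono) auto
    then show ?thesis by linarith
  qed
  then have "min (real v) (real q - real v) / real q \<le> \<bar>real v - real q * of_int k\<bar> / real q"
    by (intro divide_right_mono) auto
  also have "\<dots> = \<bar>(real v - real q * of_int k) / real q\<bar>" by simp
  also have "(real v - real q * of_int k) / real q = real v / real q - of_int k"
    using assms by (simp add: field_simps)
  finally show ?thesis by (simp add: int_dist_def k_def)
qed

text \<open>Multiplication by a unit permutes the residues, so a sum over \<open>h\<close> can be
  cut into blocks of length \<open>q\<close>, each meeting every numerator exactly once.\<close>

lemma bij_betw_mult_mod_block:
  fixes a :: int and q c :: nat
  assumes "coprime a (int q)" "q > 0"
  shows "bij_betw (\<lambda>h. nat ((int h * a) mod int q)) {c..<c+q} {..<q}"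
proof -
  have "inj_on (\<lambda>h. nat ((int h * a) mod int q)) {c..<c+q}"
  proof (rule inj_onI)
    fix h h' assume h: "h \<in> {c..<c+q}" "h' \<in> {c..<c+q}"
      and eq: "nat ((int h * a) mod int q) = nat ((int h' * a) mod int q)"
    from eq have "(int h * a) mod int q = (int h' * a) mod int q"
      using assms by (simp add: eq_nat_nat_iff)
    then have "int q dvd (int h - int h') * a" by (simp add: mod_eq_dvd_iff left_diff_distrib)
    then have "int q dvd int h - int h'"
      using assms(1) by (simp add: coprime_commute coprime_dvd_mult_left_iff)
    moreover have "\<bar>int h - int h'\<bar> < int q" using h by auto
    ultimately show "h = h'" using dvd_imp_le_int[of "int h - int h'" "int q"] by auto
  qed
  moreover have "(\<lambda>h. nat ((int h * a) mod int q)) ` {c..<c+q} \<subseteq> {..<q}"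
    using assms by (auto simp: nat_less_iff)
  ultimately show ?thesis
    unfolding bij_betw_def
    by (metis card_atLeastLessThan card_image card_lessThan card_subset_eq diff_add_inverse finite_lessThan)
qed

text \<open>The summand majorises \<open>q / min v (q - v)\<close>, the bound for the inverse
  distance of \<open>v / q\<close> to the integers. The reflection \<open>v\<close> to
  \<open>q - v\<close> turns both parts into harmonic sums; the residue 0 belongs to the multiples
  of \<open>q\<close>, which are treated separately.\<close>

lemma sum_inverse_residues_le:
  assumes "q > 0"
  shows "(\<Sum>v<q. if v = 0 then 0 else real q / real v + real q / (real q - real v))
           \<le> 2 * real q * (1 + ln (real q))"
proof -
  have eq: "{..<q} = insert 0 {1..<q}" using assms by auto
  have "(\<Sum>v<q. if v = 0 then 0 else real q / real v + real q / (real q - real v))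
      = (\<Sum>v=1..<q. real q / real v) + (\<Sum>v=1..<q. real q / (real q - real v))"
    unfolding eq by (simp add: sum.distrib)
  also have "(\<Sum>v=1..<q. real q / (real q - real v)) = (\<Sum>v=1..<q. real q / real v)"
    by (rule sum.reindex_bij_witness[of _ "\<lambda>v. q - v" "\<lambda>v. q - v"]) auto
  also have "(\<Sum>v=1..<q. real q / real v) + (\<Sum>v=1..<q. real q / real v)
      \<le> (\<Sum>v=1..q. real q / real v) + (\<Sum>v=1..q. real q / real v)"
    by (intro add_mono sum_mono2) auto
  also have "\<dots> = 2 * real q * harm q"
    by (simp add: harm_def sum_distrib_left divide_inverse mult.assoc)
  also have "\<dots> \<le> 2 * real q * (1 + ln (real q))"
    using harm_le_ln[OF assms] by (intro mult_left_mono) auto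
  finally show ?thesis .
qed

text \<open>Replacing \<open>h * y\<close> by \<open>h * a / q\<close> costs at most
  \<open>1 / (2 * q)\<close> when \<open>h \<le> K\<close>. For \<open>h\<close> not divisible by
  \<open>q\<close> the fraction is at least \<open>1 / q\<close> away from the integers, so the
  distance is at worst halved.\<close>

lemma sum_geom_bound_nonmultiples_le:
  fixes a :: int and q K :: nat and y :: real
  assumes cop: "coprime a (int q)" and q: "0 < q" "q \<le> 2 * K"
    and t: "\<bar>real q * y - of_int a\<bar> \<le> 1 / (2 * real K)"
  shows "(\<Sum>h | h \<in> {1..K} \<and> \<not> q dvd h. geom_bound K (real h * y)) \<le> 12 * K * (1 + ln (2 * real K))"
proof -
  define \<phi> where "\<phi> v = (if v = 0 then 0 else real q / real v + real q / (real q - real v))" for v :: nat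
  define V where "V h = nat ((int h * a) mod int q)" for h :: nat
  have K: "K > 0" using q by simp
  have Vlt: "V h < q" for h using q by (simp add: V_def nat_less_iff)
  have \<phi>0: "0 \<le> \<phi> (V h)" for h using Vlt[of h] by (simp add: \<phi>_def)
  have term_le: "geom_bound K (real h * y) \<le> 2 * \<phi> (V h)" if h: "h \<in> {1..K}" "\<not> q dvd h" for h
  proof -
    have "\<not> int q dvd int h * a"
      using h(2) cop by (metis coprime_commute coprime_dvd_mult_left_iff int_dvd_int_iff)
    then have "(int h * a) mod int q \<noteq> 0" by (simp add: dvd_eq_mod_eq_0)
    then have "(int h * a) mod int q > 0"
      using q pos_mod_sign[of "int q" "int h * a"] by linarith
    then have Vpos: "0 < V h" and intV: "int (V h) = (int h * a) mod int q" by (auto simp: V_def)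
    define d where "d = int_dist (real (V h) / real q)"
    define \<mu> where "\<mu> = min (real (V h)) (real q - real (V h))"
    have \<mu>: "1 \<le> \<mu>" using Vpos Vlt[of h] by (auto simp: \<mu>_def)
    have d_ge: "\<mu> / real q \<le> d" unfolding d_def \<mu>_def by (rule int_dist_div_ge) (use Vpos Vlt in auto)
    have "1 / real q \<le> \<mu> / real q" using \<mu> by (intro divide_right_mono) auto
    with d_ge have d1: "1 / real q \<le> d" by linarith
    have dpos: "0 < d" using d1 q by (smt (verit) divide_pos_pos of_nat_0_less_iff)
    define e where "e = real h * (real q * y - of_int a) / real q"
    have "\<bar>e\<bar> = real h * \<bar>real q * y - of_int a\<bar> / real q" by (simp add: e_def abs_mult)
    also have "\<dots> \<le> real K * (1 / (2 * real K)) / real q"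
      using h t by (intro divide_right_mono mult_mono) auto
    also have "\<dots> = 1 / real q / 2" using K by simp
    also have "\<dots> \<le> d / 2" using d1 by (intro divide_right_mono) auto
    finally have e: "\<bar>e\<bar> \<le> d / 2" .
    have ha: "real_of_int (int h * a) = of_int ((int h * a) div int q) * real q + real (V h)"
    proof -
      have "int h * a = (int h * a) div int q * int q + int (V h)" by (simp add: intV)
      then show ?thesis by (metis of_int_add of_int_mult of_int_of_nat_eq)
    qed
    have "real h * y = real_of_int (int h * a) / real q + e"
      using q by (simp add: e_def field_simps)
    also have "\<dots> = (real (V h) / real q + e) + of_int ((int h * a) div int q)"
      unfolding ha using q by (simp add: field_simps)
    finally have "int_dist (real h * y) = int_dist (real (V h) / real q + e)"
      by (simp only: int_dist_add_int)
    then have ge: "d / 2 \<le> int_dist (real h * y)"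
      using int_dist_add_ge[of "real (V h) / real q" e] e by (simp add: d_def)
    have "geom_bound K (real h * y) \<le> 1 / int_dist (real h * y)"
      using ge dpos by (intro geom_bound_le_inverse) linarith
    also have "\<dots> \<le> 1 / (d / 2)" using ge dpos by (intro divide_left_mono) auto
    also have "\<dots> = 2 * (1 / d)" by simp
    also have "\<dots> \<le> 2 * (1 / (\<mu> / real q))"
      using d_ge dpos \<mu> q by (intro mult_left_mono divide_left_mono) auto
    also have "\<dots> = 2 * (real q / \<mu>)" by simp
    also have "\<dots> \<le> 2 * \<phi> (V h)"
      using Vpos Vlt[of h] by (auto simp: \<phi>_def \<mu>_def min_def)
    finally show ?thesis .
  qed
  \<comment> \<open>\<open>M\<close> blocks of length \<open>q\<close> cover \<open>1..K\<close>,
    and the overshoot is at most one block; \<open>q \<le> 2 * K\<close> keeps the total length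
    below \<open>3 * K\<close>.\<close>
  define M where "M = K div q + 1"
  have KM: "K < M * q" using q by (simp add: M_def dividend_less_div_times)
  have Mq: "real M * real q \<le> 3 * real K"
  proof -
    have "M * q \<le> K + q" by (simp add: M_def)
    also have "\<dots> \<le> 3 * K" using q by simp
    finally show ?thesis by (simp flip: of_nat_mult of_nat_le_iff)
  qed
  have "(\<Sum>h | h \<in> {1..K} \<and> \<not> q dvd h. geom_bound K (real h * y))
      \<le> (\<Sum>h | h \<in> {1..K} \<and> \<not> q dvd h. 2 * \<phi> (V h))"
    by (intro sum_mono term_le) auto
  also have "\<dots> \<le> (\<Sum>h<M * q. 2 * \<phi> (V h))"
    using KM \<phi>0 by (intro sum_mono2) auto
  also have "\<dots> = (\<Sum>m<M. \<Sum>h=m * q..<m * q + q. 2 * \<phi> (V h))"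
    by (rule sum.nat_group[symmetric])
  also have "\<dots> = (\<Sum>m<M. \<Sum>v<q. 2 * \<phi> v)"
    unfolding V_def
    by (intro sum.cong refl sum.reindex_bij_betw bij_betw_mult_mod_block cop q)
  also have "\<dots> = real M * 2 * (\<Sum>v<q. \<phi> v)" by (simp add: sum_distrib_left mult.assoc)
  also have "\<dots> \<le> real M * 2 * (2 * real q * (1 + ln (real q)))"
    unfolding \<phi>_def by (intro mult_left_mono sum_inverse_residues_le q) auto
  also have "\<dots> = 4 * (real M * real q) * (1 + ln (real q))" by simp
  also have "\<dots> \<le> 4 * (3 * real K) * (1 + ln (2 * real K))"
  proof (rule mult_mono)
    show "1 + ln (real q) \<le> 1 + ln (2 * real K)"
      using q K by (subst add_le_cancel_left, subst ln_le_cancel_iff) auto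
  qed (use Mq q in \<open>auto simp: ln_ge_zero add_nonneg_nonneg\<close>)
  finally show ?thesis by simp
qed

text \<open>Interpolation between the bounds \<open>K\<close> and \<open>1 / int_dist u\<close>. An
  exponent below 1 on the distance lets the sum over the multiples of \<open>q\<close> avoid a
  logarithm; an exponent above 1/2 makes the later sum over the denominators grow like a positive
  power of the largest one.\<close>

lemma geom_bound_le_powr:
  assumes "int_dist u > 0"
  shows "geom_bound K u \<le> real K powr (1/4) * int_dist u powr (- (3/4))"
proof (cases "geom_bound K u = 0")
  case False
  then have pos: "geom_bound K u > 0" by (simp add: order_less_le)
  have "geom_bound K u = geom_bound K u powr (1/4) * geom_bound K u powr (3/4)"
    using pos by (simp flip: powr_add)
  also have "\<dots> \<le> real K powr (1/4) * (1 / int_dist u) powr (3/4)"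
    using pos geom_bound_le[of K u] geom_bound_le_inverse[OF assms, of K]
    by (intro mult_mono powr_mono2) auto
  also have "\<dots> = real K powr (1/4) * int_dist u powr (- (3/4))"
    using assms by (simp add: powr_divide powr_minus_divide)
  finally show ?thesis .
qed (simp)

lemma sum_multiples:
  fixes f :: "nat \<Rightarrow> real"
  assumes "q > 0"
  shows "(\<Sum>h | h \<in> {1..K} \<and> q dvd h. f h) = (\<Sum>j=1..K div q. f (j * q))"
proof (rule sum.reindex_bij_witness[of _ "\<lambda>j. j * q" "\<lambda>h. h div q"])
  fix j assume "j \<in> {1..K div q}"
  then have "j * q \<le> K div q * q" "1 \<le> j" by auto
  then have "j * q \<le> K" by (meson div_times_less_eq_dividend le_trans)
  with \<open>1 \<le> j\<close> assms show "j * q \<in> {h \<in> {1..K}. q dvd h}" "j * q div q = j" by auto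
qed (use assms in \<open>auto simp: div_le_mono dvd_imp_le Suc_le_eq div_greater_zero_iff\<close>)

text \<open>For \<open>h = j * q\<close> the number \<open>h * y\<close> differs from
  \<open>j * (q * y - a)\<close> by an integer, and the latter stays below 1/2 in absolute value, so
  the distance is exactly \<open>j * \<delta>\<close>. The case \<open>y = a / q\<close> has to be
  excluded because \<open>0 powr _\<close> is 0.\<close>

lemma sum_geom_bound_multiples_le:
  fixes a :: int and q K :: nat and y :: real
  assumes q: "0 < q" and K: "0 < K"
    and t: "\<bar>real q * y - of_int a\<bar> < 1 / (2 * real K)" and t0: "y \<noteq> of_int a / real q"
  shows "(\<Sum>h | h \<in> {1..K} \<and> q dvd h. geom_bound K (real h * y))
    \<le> 4 * sqrt K / real q * \<bar>y - of_int a / real q\<bar> powr (- (3/4))"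
proof -
  define \<delta> where "\<delta> = \<bar>real q * y - of_int a\<bar>"
  have \<delta>_eq: "\<delta> = real q * \<bar>y - of_int a / real q\<bar>"
  proof -
    have "real q * y - of_int a = real q * (y - of_int a / real q)" using q by (simp add: field_simps)
    then show ?thesis by (simp add: \<delta>_def abs_mult)
  qed
  have \<delta>: "0 < \<delta>" "\<delta> < 1 / (2 * real K)" using q t t0 by (auto simp: \<delta>_def field_simps)
  have "(\<Sum>h | h \<in> {1..K} \<and> q dvd h. geom_bound K (real h * y))
      = (\<Sum>j=1..K div q. geom_bound K (real (j * q) * y))"
    by (rule sum_multiples[OF q])
  also have "\<dots> \<le> (\<Sum>j=1..K div q. real K powr (1/4) * \<delta> powr (- (3/4)) * real j powr (- (3/4)))"
  proof (rule sum_mono)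
    fix j assume j: "j \<in> {1..K div q}"
    then have "j \<le> K" by (meson atLeastAtMost_iff div_le_dividend le_trans)
    have "real j * \<delta> \<le> real K * \<delta>" using \<open>j \<le> K\<close> \<delta> by (intro mult_right_mono) auto
    also have "\<dots> < real K * (1 / (2 * real K))" using \<delta> K by (intro mult_strict_left_mono) auto
    also have "\<dots> = 1 / 2" using K by simp
    finally have "\<bar>real j * (real q * y - of_int a)\<bar> < 1/2" by (simp add: abs_mult \<delta>_def)
    moreover have "real (j * q) * y = real j * (real q * y - of_int a) + of_int (int j * a)"
      by (simp add: algebra_simps)
    ultimately have d: "int_dist (real (j * q) * y) = real j * \<delta>"
      by (simp only: int_dist_add_int int_dist_eq_abs) (simp add: abs_mult \<delta>_def)
    have "geom_bound K (real (j * q) * y) \<le> real K powr (1/4) * (real j * \<delta>) powr (- (3/4))"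
      using geom_bound_le_powr[of "real (j * q) * y" K] \<delta> j unfolding d by auto
    then show "geom_bound K (real (j * q) * y)
        \<le> real K powr (1/4) * \<delta> powr (- (3/4)) * real j powr (- (3/4))"
      using \<delta> by (simp add: powr_mult mult_ac)
  qed
  also have "\<dots> = real K powr (1/4) * \<delta> powr (- (3/4)) * (\<Sum>j=1..K div q. real j powr (- (3/4)))"
    by (simp add: sum_distrib_left)
  also have "\<dots> \<le> real K powr (1/4) * \<delta> powr (- (3/4)) * (4 * (real K / real q) powr (1/4))"
  proof (rule mult_left_mono)
    have "(\<Sum>j=1..K div q. real j powr (- (3/4))) \<le> 4 * real (K div q) powr (1/4)"
      using sum_powr_neg_le[of "3/4" "K div q"] by simp
    also have "real (K div q) powr (1/4) \<le> (real K / real q) powr (1/4)"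
      by (intro powr_mono2) (auto simp: of_nat_div_le_of_nat)
    finally show "(\<Sum>j=1..K div q. real j powr (- (3/4))) \<le> 4 * (real K / real q) powr (1/4)" by simp
  qed simp
  also have "\<dots> = 4 * (real K powr (1/4) * real K powr (1/4))
      * (real q powr (- (3/4)) * real q powr (- (1/4))) * \<bar>y - of_int a / real q\<bar> powr (- (3/4))"
    using q by (simp add: \<delta>_eq powr_mult powr_divide powr_minus_divide mult_ac)
  also have "real K powr (1/4) * real K powr (1/4) = sqrt K"
    using K by (simp add: powr_half_sqrt flip: powr_add)
  also have "real q powr (- (3/4)) * real q powr (- (1/4)) = 1 / real q"
    using q by (simp add: powr_minus_divide flip: powr_add)
  finally show ?thesis by simp
qed

text \<open>The subtracted logarithmic term accounts for all \<open>h\<close> not divisible by the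
  Dirichlet denominator \<open>q\<close>, so the multiples of \<open>q\<close> alone exceed
  \<open>\<Lambda>\<close>. Their trivial bound \<open>K^2 / q\<close> limits \<open>q\<close>, and
  their interpolated bound, solved for the distance, limits
  \<open>\<bar>y - a / q\<bar>\<close>.\<close>

lemma large_sum_geom_bound_imp_near_rational:
  fixes K :: nat and y \<Lambda> :: real
  assumes K: "0 < K" and \<Lambda>: "0 < \<Lambda>"
    and large: "\<Lambda> + 12 * K * (1 + ln (2 * real K)) < (\<Sum>h=1..K. geom_bound K (real h * y))"
  obtains q :: nat and a :: int where "0 < q" "real q * \<Lambda> \<le> (real K)\<^sup>2"
    "\<bar>real q * y - of_int a\<bar> < 1"
    "\<bar>y - of_int a / real q\<bar> \<le> (4 * sqrt K / (\<Lambda> * real q)) powr (4/3)"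
proof -
  obtain a k where ak: "coprime a k" "0 < k" "k \<le> int (2 * K)"
      "\<bar>of_int k * y - of_int a\<bar> < 1 / real (2 * K)"
    using Dirichlet_approx_coprime[of "2 * K" y] K by auto
  define q where "q = nat k"
  have q: "0 < q" "q \<le> 2 * K" "coprime a (int q)" and t: "\<bar>real q * y - of_int a\<bar> < 1 / (2 * real K)"
    using ak by (auto simp: q_def)
  let ?A = "\<Sum>h | h \<in> {1..K} \<and> q dvd h. geom_bound K (real h * y)"
  have "(\<Sum>h=1..K. geom_bound K (real h * y))
      = ?A + (\<Sum>h | h \<in> {1..K} \<and> \<not> q dvd h. geom_bound K (real h * y))"
    by (subst sum.union_disjoint[symmetric]) (auto intro!: sum.cong)
  then have A: "\<Lambda> < ?A"
    using large sum_geom_bound_nonmultiples_le[of a q K y] q t by linarith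
  have "?A = (\<Sum>j=1..K div q. geom_bound K (real (j * q) * y))" by (rule sum_multiples) (rule q)
  also have "\<dots> \<le> (\<Sum>j=1..K div q. real K)" by (intro sum_mono geom_bound_le)
  also have "\<dots> = real (K div q) * real K" by simp
  also have "\<dots> \<le> (real K / real q) * real K" by (intro mult_right_mono) (auto simp: of_nat_div_le_of_nat)
  finally have "\<Lambda> \<le> (real K)\<^sup>2 / real q" using A by (simp add: power2_eq_square)
  then have 1: "real q * \<Lambda> \<le> (real K)\<^sup>2" using q by (simp add: field_simps)
  have 2: "\<bar>real q * y - of_int a\<bar> < 1"
  proof -
    have "1 / (2 * real K) \<le> 1" using K by simp
    with t show ?thesis by linarith
  qed
  let ?t = "\<bar>y - of_int a / real q\<bar>"
  have 3: "?t \<le> (4 * sqrt K / (\<Lambda> * real q)) powr (4/3)"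
  proof (cases "y = of_int a / real q")
    case False
    then have t0: "0 < ?t" by simp
    have "\<Lambda> < 4 * sqrt K / real q * ?t powr (- (3/4))"
      using A sum_geom_bound_multiples_le[OF q(1) K t False] by linarith
    then have "\<Lambda> * ?t powr (3/4) < 4 * sqrt K / real q * (?t powr (- (3/4)) * ?t powr (3/4))"
      using t0 by (simp only: mult.assoc[symmetric]) (intro mult_strict_right_mono, auto)
    also have "?t powr (- (3/4)) * ?t powr (3/4) = 1" using t0 by (simp flip: powr_add)
    finally have "?t powr (3/4) \<le> 4 * sqrt K / (\<Lambda> * real q)"
      using \<Lambda> q by (simp add: field_simps)
    then have "(?t powr (3/4)) powr (4/3) \<le> (4 * sqrt K / (\<Lambda> * real q)) powr (4/3)"
      by (intro powr_mono2) auto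
    then show ?thesis using t0 by (simp add: powr_powr)
  qed simp
  show thesis by (rule that[OF q(1) 1 2 3])
qed

text \<open>\<open>B\<close> is a union of arcs around the fractions \<open>a / (L * q)\<close> with
  \<open>q \<le> K^2 / \<Lambda>\<close>. There are at most \<open>2 * L * q\<close> arcs of radius
  \<open>\<rho> q\<close> for each \<open>q\<close>, so the measure is governed by the sum of
  \<open>q * \<rho> q\<close>, a multiple of the sum of \<open>q powr (- (1/3))\<close>.\<close>

lemma large_sum_geom_bound_measure:
  fixes K L :: nat and \<Lambda> :: real
  assumes K: "0 < K" and L: "0 < L" and \<Lambda>: "0 < \<Lambda>"
  obtains B where "B \<in> fmeasurable lborel" "measure lborel B \<le> 96 * L * ((real K)\<^sup>2 / \<Lambda>\<^sup>2)"
    "\<And>x. x \<in> {0..1} \<Longrightarrow> \<Lambda> + 12 * K * (1 + ln (2 * real K))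
        < (\<Sum>h=1..K. geom_bound K (real h * (real L * x))) \<Longrightarrow> x \<in> B"
proof -
  define \<rho> where "\<rho> q = (4 * sqrt K / (\<Lambda> * real q)) powr (4/3)" for q :: nat
  define Q where "Q = nat \<lfloor>(real K)\<^sup>2 / \<Lambda>\<rfloor>"
  define I where "I = (SIGMA q:{1..Q}. {0..L * q})"
  define J where "J = (\<lambda>(q, a). cball (real a / (real L * real q)) (\<rho> q))"
  define B where "B = (\<Union>i\<in>I. J i)"
  have finI: "finite I" by (simp add: I_def)
  have Jm: "J i \<in> fmeasurable lborel" for i
    by (cases i) (auto simp: J_def intro!: fmeasurable_compact)
  have \<rho>0: "0 \<le> \<rho> q" for q by (simp add: \<rho>_def)
  have "measure lborel B \<le> (\<Sum>i\<in>I. measure lborel (J i))"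
    unfolding B_def by (intro measure_UNION_le finI) (use fmeasurableD[OF Jm] in auto)
  also have "\<dots> = (\<Sum>(q, a)\<in>I. 2 * \<rho> q)"
    by (intro sum.cong refl) (auto simp: J_def \<rho>0 cball_eq_atLeastAtMost)
  also have "\<dots> = (\<Sum>q=1..Q. real (L * q + 1) * (2 * \<rho> q))"
    unfolding I_def by (subst sum.Sigma[symmetric]) auto
  also have "\<dots> \<le> (\<Sum>q=1..Q. 4 * L * (4 * sqrt K / \<Lambda>) powr (4/3) * real q powr (- (1/3)))"
  proof (rule sum_mono)
    fix q assume q: "q \<in> {1..Q}"
    then have "1 \<le> L * q" using L by (simp add: Suc_le_eq)
    then have "real (L * q + 1) * (2 * \<rho> q) \<le> real (2 * (L * q)) * (2 * \<rho> q)"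
      using \<rho>0[of q] by (intro mult_right_mono, subst of_nat_le_iff) auto
    also have "\<dots> = 4 * L * (real q * \<rho> q)" by simp
    also have "real q * \<rho> q = (4 * sqrt K / \<Lambda>) powr (4/3) * real q powr (- (1/3))"
    proof -
      have "real q * \<rho> q = (4 * sqrt K / \<Lambda>) powr (4/3) * (real q powr 1 * real q powr (- (4/3)))"
        using \<Lambda> q by (simp add: \<rho>_def powr_divide powr_mult powr_minus_divide)
      also have "real q powr 1 * real q powr (- (4/3)) = real q powr (- (1/3))"
        by (simp only: powr_add[symmetric]) simp
      finally show ?thesis .
    qed
    finally show "real (L * q + 1) * (2 * \<rho> q)
        \<le> 4 * L * (4 * sqrt K / \<Lambda>) powr (4/3) * real q powr (- (1/3))" by (simp only: mult.assoc)
  qed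
  also have "\<dots> = 4 * L * (4 * sqrt K / \<Lambda>) powr (4/3) * (\<Sum>q=1..Q. real q powr (- (1/3)))"
    by (simp add: sum_distrib_left)
  also have "\<dots> \<le> 4 * L * (4 * sqrt K / \<Lambda>) powr (4/3) * (3 / 2 * ((real K)\<^sup>2 / \<Lambda>) powr (2/3))"
  proof (rule mult_left_mono)
    have "(\<Sum>q=1..Q. real q powr (- (1/3))) \<le> 3 / 2 * real Q powr (2/3)"
      using sum_powr_neg_le[of "1/3" Q] by simp
    also have "real Q powr (2/3) \<le> ((real K)\<^sup>2 / \<Lambda>) powr (2/3)"
      using \<Lambda> by (intro powr_mono2) (auto simp: Q_def)
    finally show "(\<Sum>q=1..Q. real q powr (- (1/3))) \<le> 3 / 2 * ((real K)\<^sup>2 / \<Lambda>) powr (2/3)" by simp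
  qed simp
  also have "\<dots> = 6 * L * 4 powr (4/3) * ((real K)\<^sup>2 / \<Lambda>\<^sup>2)"
  proof -
    have "(4 * sqrt K / \<Lambda>) powr (4/3) = 4 powr (4/3) * real K powr (2/3) * \<Lambda> powr (- (4/3))"
      using \<Lambda> K by (simp add: powr_divide powr_mult powr_minus_divide powr_powr flip: powr_half_sqrt)
    moreover have "((real K)\<^sup>2 / \<Lambda>) powr (2/3) = real K powr (4/3) * \<Lambda> powr (- (2/3))"
      using \<Lambda> K by (simp add: powr_divide powr_minus_divide powr_powr flip: powr_numeral)
    moreover have "real K powr (2/3) * real K powr (4/3) = (real K)\<^sup>2"
      using K by (simp flip: powr_add)
    moreover have "\<Lambda> powr (- (4/3)) * \<Lambda> powr (- (2/3)) = 1 / \<Lambda>\<^sup>2"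
    proof -
      have "\<Lambda> powr (- (4/3)) * \<Lambda> powr (- (2/3)) = \<Lambda> powr (- 2)" by (simp flip: powr_add)
      then show ?thesis using \<Lambda> by (simp add: powr_minus_divide)
    qed
    ultimately have "(4 * sqrt K / \<Lambda>) powr (4/3) * ((real K)\<^sup>2 / \<Lambda>) powr (2/3)
        = 4 powr (4/3) * (real K)\<^sup>2 * (1 / \<Lambda>\<^sup>2)"
      by (smt (verit) mult.assoc mult.commute)
    then show ?thesis by simp
  qed
  also have "\<dots> \<le> 6 * L * 16 * ((real K)\<^sup>2 / \<Lambda>\<^sup>2)"
  proof -
    have "(4::real) powr (4/3) \<le> 4 powr 2" by (intro powr_mono) auto
    also have "\<dots> = 16" by simp
    finally have "6 * real L * 4 powr (4/3) \<le> 6 * real L * 16" by (intro mult_left_mono) auto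
    then show ?thesis by (intro mult_right_mono) auto
  qed
  finally have meas: "measure lborel B \<le> 96 * L * ((real K)\<^sup>2 / \<Lambda>\<^sup>2)" by simp
  have cover: "x \<in> B" if x: "x \<in> {0..1}" and large: "\<Lambda> + 12 * K * (1 + ln (2 * real K))
        < (\<Sum>h=1..K. geom_bound K (real h * (real L * x)))" for x
  proof -
    obtain q :: nat and a :: int where qa: "0 < q" "real q * \<Lambda> \<le> (real K)\<^sup>2"
      "\<bar>real q * (real L * x) - of_int a\<bar> < 1" "\<bar>real L * x - of_int a / real q\<bar> \<le> \<rho> q"
      unfolding \<rho>_def by (rule large_sum_geom_bound_imp_near_rational[OF K \<Lambda> large]) blast
    have "real q \<le> (real K)\<^sup>2 / \<Lambda>" using qa \<Lambda> by (simp add: field_simps)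
    then have "q \<le> Q" unfolding Q_def by (simp add: le_nat_floor)
    \<comment> \<open>Since \<open>q * L * x\<close> lies in \<open>[0, L * q]\<close> and
      \<open>a\<close> is at distance less than 1 from it, the integer \<open>a\<close> lies in the
      same interval.\<close>
    have "0 \<le> real q * (real L * x)" using x by simp
    with qa(3) have "real_of_int (- 1) < of_int a" by simp
    then have a0: "0 \<le> a" by linarith
    have "real q * (real L * x) \<le> real q * (real L * 1)" using x by (intro mult_left_mono) auto
    with qa(3) have "real_of_int a < of_int (int (L * q) + 1)" by (simp add: mult.commute)
    then have a1: "a \<le> int (L * q)" by linarith
    have I: "(q, nat a) \<in> I" using \<open>q \<le> Q\<close> qa(1) a0 a1 by (auto simp: I_def nat_le_iff)
    have "real (nat a) / (real L * real q) - x = - (real L * x - of_int a / real q) / real L"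
      using L qa(1) a0 by (simp add: field_simps)
    then have "\<bar>real (nat a) / (real L * real q) - x\<bar> = \<bar>real L * x - of_int a / real q\<bar> / real L"
      by (simp add: abs_minus_commute)
    \<comment> \<open>Passing from \<open>L * x\<close> to \<open>x\<close> shrinks the arc by the
      factor \<open>L\<close>; this gain is given away.\<close>
    also have "\<dots> \<le> \<bar>real L * x - of_int a / real q\<bar> / 1"
      using L by (intro divide_left_mono) auto
    finally have "x \<in> J (q, nat a)" using qa(4) by (simp add: J_def dist_real_def)
    with I show ?thesis unfolding B_def by blast
  qed
  have "B \<in> fmeasurable lborel" unfolding B_def using finI Jm by (intro fmeasurable.finite_UN) auto
  from that[OF this meas cover] show thesis .
qed

section \<open>Dyadic blocks\<close>

text \<open>The character is constant on a residue class and is factored out, which leaves a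
  quadratic exponential sum with monotone weights.\<close>

definition residue_block :: "real \<Rightarrow> nat \<Rightarrow> nat \<Rightarrow> nat \<Rightarrow> real \<Rightarrow> complex" where
  "residue_block s N r K x = (\<Sum>l<K. of_real (real (N * (K + l) + r) powr (- s))
      * cis (- 2 * pi * (real (N * (K + l) + r))\<^sup>2 * x))"

text \<open>As a function of \<open>l\<close> the phase is a quadratic polynomial with leading
  coefficient \<open>- N^2 * x\<close>, so Weyl differencing applies with
  \<open>y = - 2 * N^2 * x\<close>; \<open>geom_bound\<close> is even, so the sign drops
  out.\<close>

lemma residue_block_power2_le:
  assumes N: "0 < N" and K: "0 < K" and s: "0 < s"
  shows "(cmod (residue_block s N r K x))\<^sup>2
    \<le> (real K powr (- s))\<^sup>2 * (K + 2 * (\<Sum>h=1..K. geom_bound K (real h * (real (2 * N\<^sup>2) * x))))"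
proof -
  define w where "w l = real (N * (K + l) + r) powr (- s)" for l
  define R where "R = real (N * K + r)"
  have pos: "0 < real (N * (K + l) + r)" for l
    using N K by (simp only: of_nat_0_less_iff) simp
  have w: "decseq w" "\<And>n. 0 \<le> w n"
    unfolding decseq_def w_def using pos s by (auto intro!: powr_mono2' simp del: of_nat_add of_nat_mult)
  have phase: "- 2 * pi * (real (N * (K + l) + r))\<^sup>2 * x
     = 2 * pi * ((- (real (2 * N\<^sup>2) * x)) * (real l)\<^sup>2 / 2 + (- 2 * real N * R * x) * l + (- R\<^sup>2 * x))" for l
    by (simp add: R_def power2_eq_square algebra_simps)
  have "K \<le> N * K + r" using N by (simp add: trans_le_add1)
  then have "w 0 \<le> real K powr (- s)"
    unfolding w_def using K s by (intro powr_mono2') (auto simp del: of_nat_add of_nat_mult)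
  then have "(w 0)\<^sup>2 \<le> (real K powr (- s))\<^sup>2" using w(2) by (intro power_mono) auto
  have "(cmod (residue_block s N r K x))\<^sup>2
      \<le> (w 0)\<^sup>2 * (K + 2 * (\<Sum>h=1..K. geom_bound K (real h * (- (real (2 * N\<^sup>2) * x)))))"
    unfolding residue_block_def phase w_def[symmetric] by (rule weyl_differencing[OF w])
  also have "\<dots> = (w 0)\<^sup>2 * (K + 2 * (\<Sum>h=1..K. geom_bound K (real h * (real (2 * N\<^sup>2) * x))))"
    by (simp only: mult_minus_right geom_bound_minus)
  also have "\<dots> \<le> (real K powr (- s))\<^sup>2 * (K + 2 * (\<Sum>h=1..K. geom_bound K (real h * (real (2 * N\<^sup>2) * x))))"
    by (intro mult_right_mono add_nonneg_nonneg mult_nonneg_nonneg sum_nonneg) (use \<open>(w 0)\<^sup>2 \<le> _\<close> in auto)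
  finally show ?thesis .
qed

text \<open>The measure bound is applied with \<open>\<Lambda> = \<tau>^2 / 4\<close> and
  \<open>L = 2 * N^2\<close>. From \<open>\<tau>^2 < K + 2 * F\<close> one needs
  \<open>\<tau>^2 / 4\<close> to dominate \<open>K / 2\<close> plus the logarithmic term with
  constant 12; hence \<open>50 = 4 * (12 + 1/2)\<close>.\<close>

lemma residue_block_level_set:
  fixes s \<tau> :: real
  assumes N: "0 < N" and K: "0 < K" and s: "0 < s" and \<tau>: "0 < \<tau>"
    and large: "50 * K * (1 + ln (2 * real K)) \<le> \<tau>\<^sup>2"
  obtains B where "B \<in> fmeasurable lborel" "measure lborel B \<le> 3072 * (real N)\<^sup>2 * ((real K)\<^sup>2 / \<tau> ^ 4)"
    "\<And>x. x \<in> {0..1} \<Longrightarrow> \<tau> * real K powr (- s) < cmod (residue_block s N r K x) \<Longrightarrow> x \<in> B"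
proof -
  obtain B where B: "B \<in> fmeasurable lborel"
      "measure lborel B \<le> 96 * real (2 * N\<^sup>2) * ((real K)\<^sup>2 / (\<tau>\<^sup>2 / 4)\<^sup>2)"
    and cover: "\<And>x. x \<in> {0..1} \<Longrightarrow> \<tau>\<^sup>2 / 4 + 12 * K * (1 + ln (2 * real K))
        < (\<Sum>h=1..K. geom_bound K (real h * (real (2 * N\<^sup>2) * x))) \<Longrightarrow> x \<in> B"
    using large_sum_geom_bound_measure[OF K, of "2 * N\<^sup>2" "\<tau>\<^sup>2 / 4"] N \<tau> by auto
  have "x \<in> B" if x: "x \<in> {0..1}" "\<tau> * real K powr (- s) < cmod (residue_block s N r K x)" for x
  proof (rule cover[OF x(1)])
    let ?F = "\<Sum>h=1..K. geom_bound K (real h * (real (2 * N\<^sup>2) * x))"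
    have "(\<tau> * real K powr (- s))\<^sup>2 < (cmod (residue_block s N r K x))\<^sup>2"
      using x(2) \<tau> by (intro power_strict_mono) auto
    also have "\<dots> \<le> (real K powr (- s))\<^sup>2 * (K + 2 * ?F)" by (rule residue_block_power2_le[OF N K s])
    finally have "(real K powr (- s))\<^sup>2 * \<tau>\<^sup>2 < (real K powr (- s))\<^sup>2 * (K + 2 * ?F)"
      by (simp add: power_mult_distrib mult.commute)
    then have "\<tau>\<^sup>2 < K + 2 * ?F" by (rule mult_left_less_imp_less) simp
    moreover have "real K * 1 \<le> real K * (1 + ln (2 * real K))"
      using K by (intro mult_left_mono) auto
    ultimately show "\<tau>\<^sup>2 / 4 + 12 * K * (1 + ln (2 * real K)) < ?F" using large by simp
  qed
  moreover have "96 * real (2 * N\<^sup>2) * ((real K)\<^sup>2 / (\<tau>\<^sup>2 / 4)\<^sup>2) = 3072 * (real N)\<^sup>2 * ((real K)\<^sup>2 / \<tau> ^ 4)"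
    by (simp add: power_divide flip: power_mult)
  ultimately show thesis using that[OF B(1)] B(2) by metis
qed

section \<open>Decomposition of the partial sums into residue blocks\<close>

lemma periodic_mod:
  fixes f :: "nat \<Rightarrow> 'a"
  assumes "\<And>n. f (n + N) = f n"
  shows "f (N * k + r) = f r"
proof (induction k)
  case (Suc k)
  have "f (N * Suc k + r) = f (N * k + r + N)" by (simp add: algebra_simps)
  then show ?case using Suc assms by simp
qed simp

text \<open>The term \<open>n = 0\<close> may be added because \<open>0 powr _\<close> is 0; the
  range \<open>{..<M}\<close> then splits evenly into residue classes when \<open>N\<close> divides
  \<open>M\<close>.\<close>

lemma m_partial_eq:
  assumes "0 < M"
  shows "m_partial s chi (M - 1) x
    = (\<Sum>n<M. chi n * (of_real (real n powr (- s)) * cis (- 2 * pi * (real n)\<^sup>2 * x)))"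
proof -
  have "chi n * exp (- 2 * pi * \<i> * of_nat (n^2) * of_real x) / of_real (real n powr s)
      = chi n * (of_real (real n powr (- s)) * cis (- 2 * pi * (real n)\<^sup>2 * x))" for n
    by (simp add: cis_conv_exp powr_minus divide_inverse mult_ac)
  then have "m_partial s chi (M - 1) x
      = (\<Sum>n=1..M - 1. chi n * (of_real (real n powr (- s)) * cis (- 2 * pi * (real n)\<^sup>2 * x)))"
    by (simp add: m_partial_def)
  also have "\<dots> = (\<Sum>n<M. chi n * (of_real (real n powr (- s)) * cis (- 2 * pi * (real n)\<^sup>2 * x)))"
    using assms by (intro sum.mono_neutral_left) (auto simp: not_le)
  finally show ?thesis .
qed

lemma m_partial_double:
  assumes per: "\<And>n. chi (n + N) = chi n" and N: "0 < N" and K: "0 < K"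
  shows "m_partial s chi (N * (2 * K) - 1) x
    = m_partial s chi (N * K - 1) x + (\<Sum>r<N. chi r * residue_block s N r K x)"
proof -
  define f where "f n = chi n * (of_real (real n powr (- s)) * cis (- 2 * pi * (real n)\<^sup>2 * x))" for n
  have "m_partial s chi (N * (2 * K) - 1) x = (\<Sum>n<N * (2 * K). f n)"
    using N K by (subst m_partial_eq) (auto simp: f_def)
  also have "{..<N * (2 * K)} = {..<N * K} \<union> {N * K..<N * K + N * K}" by auto
  also have "sum f \<dots> = (\<Sum>n<N * K. f n) + (\<Sum>n=N * K..<N * K + N * K. f n)"
    by (intro sum.union_disjoint) auto
  also have "(\<Sum>n<N * K. f n) = m_partial s chi (N * K - 1) x"
    using N K by (subst m_partial_eq) (auto simp: f_def)
  also have "(\<Sum>n=N * K..<N * K + N * K. f n) = (\<Sum>n<K * N. f (N * K + n))"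
    by (rule sum.reindex_bij_witness[of _ "\<lambda>n. N * K + n" "\<lambda>n. n - N * K"]) (auto simp: mult.commute)
  also have "\<dots> = (\<Sum>l<K. \<Sum>n=l * N..<l * N + N. f (N * K + n))"
    by (rule sum.nat_group[symmetric])
  also have "\<dots> = (\<Sum>l<K. \<Sum>r<N. f (N * (K + l) + r))"
  proof (rule sum.cong[OF refl])
    fix l
    show "(\<Sum>n=l * N..<l * N + N. f (N * K + n)) = (\<Sum>r<N. f (N * (K + l) + r))"
      by (rule sum.reindex_bij_witness[of _ "\<lambda>r. l * N + r" "\<lambda>n. n - l * N"]) (auto simp: algebra_simps)
  qed
  also have "\<dots> = (\<Sum>r<N. \<Sum>l<K. f (N * (K + l) + r))" by (rule sum.swap)
  also have "\<dots> = (\<Sum>r<N. chi r * residue_block s N r K x)"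
    unfolding f_def periodic_mod[of chi N, OF per] residue_block_def sum_distrib_left ..
  finally show ?thesis .
qed

lemma m_partial_dyadic:
  assumes per: "\<And>n. chi (n + N) = chi n" and N: "0 < N" and "J \<le> J'"
  shows "m_partial s chi (N * 2 ^ J' - 1) x = m_partial s chi (N * 2 ^ J - 1) x
    + (\<Sum>j=J..<J'. \<Sum>r<N. chi r * residue_block s N r (2 ^ j) x)"
  using \<open>J \<le> J'\<close>
proof (induction J' rule: dec_induct)
  case (step j)
  have "m_partial s chi (N * 2 ^ Suc j - 1) x
      = m_partial s chi (N * 2 ^ j - 1) x + (\<Sum>r<N. chi r * residue_block s N r (2 ^ j) x)"
    using m_partial_double[of chi N "2 ^ j" s x, OF per N] by simp
  with step show ?case by simp
qed simp

text \<open>By periodicity the sum of \<open>cmod (chi r)\<close> over one period bounds every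
  \<open>cmod (chi n)\<close>; the rest is the comparison of the sum of \<open>n powr (- s)\<close>
  with an integral.\<close>

lemma cmod_m_partial_le:
  assumes per: "\<And>n. chi (n + N) = chi n" and N: "0 < N" and M: "0 < M" and s: "0 < s" "s < 1"
  shows "cmod (m_partial s chi (M - 1) x) \<le> (\<Sum>r<N. cmod (chi r)) * (real M powr (1 - s) / (1 - s))"
proof -
  let ?b = "\<Sum>r<N. cmod (chi r)"
  have chi: "cmod (chi n) \<le> ?b" for n
  proof -
    have "chi n = chi (n mod N)" using periodic_mod[of chi N "n div N" "n mod N", OF per] by simp
    then show ?thesis using N by (auto intro!: member_le_sum)
  qed
  have "cmod (m_partial s chi (M - 1) x) \<le> (\<Sum>n<M. ?b * real n powr (- s))"
    unfolding m_partial_eq[OF M]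
    by (intro sum_norm_le) (auto simp: norm_mult intro!: mult_right_mono chi)
  also have "\<dots> = ?b * (\<Sum>n<M. real n powr (- s))" by (simp add: sum_distrib_left)
  also have "(\<Sum>n<M. real n powr (- s)) = (\<Sum>n=1..M - 1. real n powr (- s))"
    using M by (intro sum.mono_neutral_right) (auto simp: not_le)
  also have "\<dots> \<le> (\<Sum>n=1..M. real n powr (- s))" by (intro sum_mono2) auto
  also have "\<dots> \<le> real M powr (1 - s) / (1 - s)" by (rule sum_powr_neg_le[OF s])
  finally show ?thesis by (simp add: mult_left_mono sum_nonneg)
qed

section \<open>Level sets of the dyadic partial sums\<close>

lemma sum_geometric_shift_le:
  fixes \<rho> :: real
  assumes "0 \<le> \<rho>" "\<rho> < 1"
  shows "(\<Sum>j=J..<J'. \<rho> ^ (j - J)) \<le> 1 / (1 - \<rho>)"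
proof -
  have "(\<Sum>j=J..<J'. \<rho> ^ (j - J)) = (\<Sum>i<J' - J. \<rho> ^ i)"
    by (rule sum.reindex_bij_witness[of _ "\<lambda>i. J + i" "\<lambda>j. j - J"]) auto
  also have "\<dots> \<le> (\<Sum>i. \<rho> ^ i)" using assms by (intro sum_le_suminf summable_geometric) auto
  also have "\<dots> = 1 / (1 - \<rho>)" using assms by (intro suminf_geometric) auto
  finally show ?thesis .
qed


text \<open>For \<open>K = 2 ^ j\<close> the logarithm is linear in \<open>j\<close>, hence beaten
  by any exponential. This supplies the largeness condition on \<open>\<tau>^2\<close> for all
  sufficiently long blocks.\<close>

lemma eventually_log_le_powr:
  fixes \<eta> :: real
  assumes "0 < \<eta>"
  shows "\<forall>\<^sub>F j in sequentially. 50 * (1 + ln (2 * 2 ^ j)) \<le> 2 powr (2 * \<eta> * real j)"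
proof -
  define x where "x = (2::real) powr (- (2 * \<eta>))"
  have x: "0 < x" "x < 1" using assms powr_less_mono[of "- (2 * \<eta>)" 0 2] by (auto simp: x_def)
  have "(\<lambda>j. 50 * (1 + ln 2) * x ^ j + 50 * ln 2 * (of_nat j * x ^ j)) \<longlonglongrightarrow> 50 * (1 + ln 2) * 0 + 50 * ln 2 * 0"
    using x by (intro tendsto_intros LIMSEQ_power_zero powser_times_n_limit_0) auto
  then have "\<forall>\<^sub>F j in sequentially. 50 * (1 + ln 2) * x ^ j + 50 * ln 2 * (of_nat j * x ^ j) < 1"
    by (rule order_tendstoD) simp
  then show ?thesis
  proof eventually_elim
    case (elim j)
    have "50 * (1 + ln (2 * 2 ^ j)) * x ^ j < 1"
      using elim by (simp add: ln_mult ln_realpow algebra_simps)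
    moreover have "x ^ j * 2 powr (2 * \<eta> * real j) = 1"
      by (simp add: x_def powr_power mult_ac flip: powr_add)
    ultimately show ?case using x
      by (smt (verit) mult.commute mult_le_cancel_left_pos zero_less_power)
  qed
qed

text \<open>The terms below \<open>N * 2 ^ J\<close> are bounded pointwise; each later block gets
  its own threshold \<open>\<mu> j\<close>, decaying geometrically, and an exceptional set. Both the
  thresholds and the measures sum to bounds free of \<open>J'\<close>, as the passage to the limit
  requires.\<close>

lemma m_partial_level_set:
  fixes s :: real
  assumes per: "\<And>n. chi (n + N) = chi n" and N: "0 < N" and s: "1/2 < s" "s < 1"
  obtains C D :: real and J0 :: nat where "0 \<le> C" "0 < D"
    "\<And>J J'. J0 \<le> J \<Longrightarrow> J \<le> J' \<Longrightarrow> \<exists>B \<in> fmeasurable lborel. measure lborel B \<le> C * 2 powr (- 2 * real J) \<and>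
        (\<forall>x\<in>{0..1}. D * 2 powr (real J * (1 - s)) < cmod (m_partial s chi (N * 2 ^ J' - 1) x) \<longrightarrow> x \<in> B)"
proof -
  \<comment> \<open>With thresholds constant in \<open>j\<close>, the ratio
    \<open>\<tau>^2 / K\<close> would grow like \<open>2 powr (4 * \<eta> * j)\<close>. Letting the
    thresholds decay by \<open>\<rho> = 2 powr (- \<eta>)\<close> per block spends half of this
    exponent; the other half absorbs the logarithm and, as the measure is of order
    \<open>(\<tau>^2 / K)^(-2)\<close>, yields the ratio \<open>\<sigma>\<close>.\<close>
  define \<eta> where "\<eta> = (2 * s - 1) / 4"
  have \<eta>: "0 < \<eta>" and s_eq: "s = 1/2 + 2 * \<eta>" using s by (auto simp: \<eta>_def field_simps)
  define b where "b = (\<Sum>r<N. cmod (chi r))"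
  have b0: "0 \<le> b" by (simp add: b_def sum_nonneg)
  define \<rho> where "\<rho> = (2::real) powr (- \<eta>)"
  define \<sigma> where "\<sigma> = (2::real) powr (- (4 * \<eta>))"
  have \<rho>: "0 < \<rho>" "\<rho> < 1" using \<eta> powr_less_mono[of "- \<eta>" 0 2] by (auto simp: \<rho>_def)
  have \<sigma>: "0 < \<sigma>" "\<sigma> < 1" using \<eta> powr_less_mono[of "- (4 * \<eta>)" 0 2] by (auto simp: \<sigma>_def)
  obtain J0 where J0: "\<And>j. J0 \<le> j \<Longrightarrow> 50 * (1 + ln (2 * 2 ^ j)) \<le> 2 powr (2 * \<eta> * real j)"
    using eventually_log_le_powr[OF \<eta>] by (auto simp: eventually_sequentially)
  define C where "C = real N * (3072 * (real N)\<^sup>2) * (1 / (1 - \<sigma>))"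
  \<comment> \<open>The first two summands come from the initial terms and from the sum of the
    thresholds; the last one makes \<open>D\<close> positive whatever \<open>b\<close> is.\<close>
  define D where "D = b * (real N powr (1 - s) / (1 - s)) + b * (1 / (1 - \<rho>)) + 1"
  have C0: "0 \<le> C" using \<sigma> by (simp add: C_def)
  have D0: "0 < D" using b0 \<rho> s unfolding D_def by (intro add_nonneg_pos add_nonneg_nonneg mult_nonneg_nonneg) auto
  have main: "\<exists>B \<in> fmeasurable lborel. measure lborel B \<le> C * 2 powr (- 2 * real J) \<and>
        (\<forall>x\<in>{0..1}. D * 2 powr (real J * (1 - s)) < cmod (m_partial s chi (N * 2 ^ J' - 1) x) \<longrightarrow> x \<in> B)"
    if J: "J0 \<le> J" "J \<le> J'" for J J'
  proof -
    define X where "X = 2 powr (real J * (1 - s))"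
    have X0: "0 < X" by (simp add: X_def)
    define \<mu> where "\<mu> j = X * \<rho> ^ (j - J)" for j
    have ex: "\<exists>B \<in> fmeasurable lborel. measure lborel B \<le> 3072 * (real N)\<^sup>2 * (2 powr (- 2 * real J) * \<sigma> ^ (j - J)) \<and>
        (\<forall>x\<in>{0..1}. \<mu> j < cmod (residue_block s N r (2 ^ j) x) \<longrightarrow> x \<in> B)" if j: "J \<le> j" for j r
    proof -
      define i where "i = j - J"
      have ji: "real j = real J + real i" using j by (simp add: i_def)
      \<comment> \<open>Chosen so that \<open>\<tau> = 2 powr e\<close>, rescaled by the weight
        \<open>(2 ^ j) powr (- s)\<close>, is the threshold \<open>\<mu> j\<close>.\<close>
      define e where "e = real J * (1 - s) - \<eta> * real i + real j * s"
      have \<mu>_eq: "2 powr e * real (2 ^ j) powr (- s) = \<mu> j"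
        by (simp add: e_def \<mu>_def X_def \<rho>_def i_def powr_power powr_powr mult_ac flip: powr_realpow powr_add)
      have e_ge: "real j + 2 * \<eta> * real j \<le> 2 * e"
      proof -
        have "2 * e - (real j + 2 * \<eta> * real j) = 2 * real J * (1 - s) + 2 * \<eta> * real J"
          unfolding e_def ji s_eq by (simp add: algebra_simps)
        moreover have "0 \<le> 2 * real J * (1 - s) + 2 * \<eta> * real J" using s \<eta> by simp
        ultimately show ?thesis by linarith
      qed
      have "50 * (1 + ln (2 * 2 ^ j)) \<le> 2 powr (2 * \<eta> * real j)" using J j by (intro J0) simp
      then have "2 powr real j * (50 * (1 + ln (2 * 2 ^ j))) \<le> 2 powr real j * 2 powr (2 * \<eta> * real j)"
        by (intro mult_left_mono) auto
      also have "\<dots> \<le> 2 powr (2 * e)" using e_ge by (simp flip: powr_add)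
      also have "\<dots> = (2 powr e)\<^sup>2" by (simp add: powr_power mult.commute)
      finally have large: "50 * real (2 ^ j) * (1 + ln (2 * real (2 ^ j))) \<le> (2 powr e)\<^sup>2"
        by (simp add: powr_realpow mult_ac)
      obtain B where B: "B \<in> fmeasurable lborel"
          "measure lborel B \<le> 3072 * (real N)\<^sup>2 * ((real (2 ^ j))\<^sup>2 / (2 powr e) ^ 4)"
          "\<And>x. x \<in> {0..1} \<Longrightarrow> 2 powr e * real (2 ^ j) powr (- s) < cmod (residue_block s N r (2 ^ j) x) \<Longrightarrow> x \<in> B"
        using residue_block_level_set[OF N _ _ _ large, of s r] s by auto
      have "(real (2 ^ j))\<^sup>2 / (2 powr e) ^ 4 = (2 powr real j)\<^sup>2 / (2 powr e) ^ 4"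
        by (simp add: powr_realpow)
      also have "\<dots> = 2 powr (2 * real j - 4 * e)"
        by (simp add: powr_diff powr_power mult.commute)
      also have "2 * real j - 4 * e = - 2 * real J - 4 * \<eta> * real i"
        unfolding e_def ji s_eq by (simp add: algebra_simps)
      also have "2 powr (- 2 * real J - 4 * \<eta> * real i) = 2 powr (- 2 * real J) * \<sigma> ^ (j - J)"
        by (simp add: \<sigma>_def powr_power i_def mult_ac flip: powr_add)
      finally show ?thesis using B unfolding \<mu>_eq by auto
    qed
    define good where "good j r B \<longleftrightarrow> B \<in> fmeasurable lborel \<and>
        measure lborel B \<le> 3072 * (real N)\<^sup>2 * (2 powr (- 2 * real J) * \<sigma> ^ (j - J)) \<and>
        (\<forall>x\<in>{0..1}. \<mu> j < cmod (residue_block s N r (2 ^ j) x) \<longrightarrow> x \<in> B)" for j r B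
    define E where "E j r = (SOME B. good j r B)" for j r
    have good: "good j r (E j r)" if "J \<le> j" for j r
      unfolding E_def by (rule someI_ex) (use ex[OF that, of r] in \<open>auto simp: good_def\<close>)
    have E: "E j r \<in> fmeasurable lborel"
        "measure lborel (E j r) \<le> 3072 * (real N)\<^sup>2 * (2 powr (- 2 * real J) * \<sigma> ^ (j - J))"
      if "J \<le> j" for j r
      using good[OF that, of r] unfolding good_def by blast+
    have E_cover: "cmod (residue_block s N r (2 ^ j) x) \<le> \<mu> j"
      if "J \<le> j" "x \<in> {0..1}" "x \<notin> E j r" for j r x
      using good[OF that(1), of r] that(2,3) unfolding good_def by (meson not_less)
    define B where "B = (\<Union>(j, r) \<in> {J..<J'} \<times> {..<N}. E j r)"
    have Bm: "B \<in> fmeasurable lborel" unfolding B_def by (intro fmeasurable.finite_UN) (auto intro: E)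
    have "measure lborel B \<le> (\<Sum>(j, r) \<in> {J..<J'} \<times> {..<N}. measure lborel (E j r))"
      unfolding B_def case_prod_unfold
      by (rule measure_UNION_le) (use fmeasurableD[OF E(1)] in auto)
    also have "\<dots> \<le> (\<Sum>(j, r) \<in> {J..<J'} \<times> {..<N}. 3072 * (real N)\<^sup>2 * (2 powr (- 2 * real J) * \<sigma> ^ (j - J)))"
      by (rule sum_mono) (use E(2) in auto)
    also have "\<dots> = (\<Sum>j=J..<J'. real N * (3072 * (real N)\<^sup>2 * (2 powr (- 2 * real J) * \<sigma> ^ (j - J))))"
      by (subst sum.cartesian_product[symmetric]) simp
    also have "\<dots> = real N * (3072 * (real N)\<^sup>2) * 2 powr (- 2 * real J) * (\<Sum>j=J..<J'. \<sigma> ^ (j - J))"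
      unfolding sum_distrib_left by (simp only: mult.assoc)
    also have "\<dots> \<le> real N * (3072 * (real N)\<^sup>2) * 2 powr (- 2 * real J) * (1 / (1 - \<sigma>))"
      by (intro mult_left_mono sum_geometric_shift_le) (use \<sigma> in auto)
    also have "\<dots> = C * 2 powr (- 2 * real J)" by (simp add: C_def)
    finally have meas: "measure lborel B \<le> C * 2 powr (- 2 * real J)" .
    have cover: "x \<in> B" if x: "x \<in> {0..1}" "D * X < cmod (m_partial s chi (N * 2 ^ J' - 1) x)" for x
    proof (rule ccontr)
      assume "x \<notin> B"
      then have notE: "x \<notin> E j r" if "j \<in> {J..<J'}" "r \<in> {..<N}" for j r
        using that by (auto simp: B_def)
      have "cmod (\<Sum>j=J..<J'. \<Sum>r<N. chi r * residue_block s N r (2 ^ j) x)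
          \<le> (\<Sum>j=J..<J'. \<Sum>r<N. cmod (chi r) * \<mu> j)"
        by (intro sum_norm_le) (use notE x(1) in \<open>auto simp: norm_mult intro!: mult_left_mono E_cover\<close>)
      also have "\<dots> = b * X * (\<Sum>j=J..<J'. \<rho> ^ (j - J))"
        by (simp add: b_def \<mu>_def mult_ac flip: sum_distrib_left sum_distrib_right)
      also have "\<dots> \<le> b * X * (1 / (1 - \<rho>))"
        by (intro mult_left_mono sum_geometric_shift_le) (use \<rho> b0 X0 in auto)
      finally have tail: "cmod (\<Sum>j=J..<J'. \<Sum>r<N. chi r * residue_block s N r (2 ^ j) x) \<le> b * (1 / (1 - \<rho>)) * X"
        by (simp add: mult_ac)
      have "cmod (m_partial s chi (N * 2 ^ J - 1) x) \<le> b * (real (N * 2 ^ J) powr (1 - s) / (1 - s))"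
        unfolding b_def by (rule cmod_m_partial_le[of chi N, OF per N]) (use N s in auto)
      also have "real (N * 2 ^ J) powr (1 - s) = real N powr (1 - s) * X"
        by (simp add: powr_mult X_def powr_powr flip: powr_realpow)
      finally have head: "cmod (m_partial s chi (N * 2 ^ J - 1) x) \<le> b * (real N powr (1 - s) / (1 - s)) * X"
        by simp
      have "cmod (m_partial s chi (N * 2 ^ J' - 1) x) \<le> (D - 1) * X"
        unfolding m_partial_dyadic[of chi N, OF per N J(2)]
        using norm_triangle_le[OF add_mono[OF head tail]] by (simp add: D_def algebra_simps)
      also have "\<dots> \<le> D * X" using X0 by simp
      finally show False using x(2) by simp
    qed
    show ?thesis using Bm meas cover unfolding X_def by blast
  qed
  show thesis by (rule that[OF C0 D0 main])
qed

section \<open>The weak-type bound\<close>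

text \<open>If \<open>cmod (m x) > \<alpha>\<close>, then \<open>f K x\<close> exceeds
  \<open>\<alpha> / 2\<close> or differs from \<open>m x\<close> by at least
  \<open>\<alpha> / 2\<close>; Chebyshev's inequality makes the second set arbitrarily small.
  Infinitely many \<open>K\<close> suffice, which matters because level sets are controlled only for
  \<open>K = N * 2 ^ J' - 1\<close>.\<close>

lemma measure_le_of_L2_approx:
  fixes f :: "nat \<Rightarrow> real \<Rightarrow> complex" and m :: "real \<Rightarrow> complex"
  assumes f [measurable]: "\<And>K. f K \<in> borel_measurable lborel" and m [measurable]: "m \<in> borel_measurable lborel"
    and lim: "(\<lambda>K. \<integral>\<^sup>+ x. ennreal ((cmod (f K x - m x))\<^sup>2) * indicator {0..1} x \<partial>lborel) \<longlonglongrightarrow> 0"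
    and \<alpha>: "0 < \<alpha>"
    and level: "\<exists>\<^sub>F K in sequentially. \<exists>B \<in> fmeasurable lborel. measure lborel B \<le> A \<and>
        (\<forall>x\<in>{0..1}. \<alpha> / 2 < cmod (f K x) \<longrightarrow> x \<in> B)"
  shows "measure lborel {x \<in> {0..1}. cmod (m x) > \<alpha>} \<le> A"
proof (rule field_le_epsilon)
  fix e :: real assume e: "0 < e"
  define I where "I K = (\<integral>\<^sup>+ x. ennreal ((cmod (f K x - m x))\<^sup>2) * indicator {0..1} x \<partial>lborel)" for K
  have "\<forall>\<^sub>F K in sequentially. I K < ennreal (e * (\<alpha> / 2)\<^sup>2)"
    using lim unfolding I_def by (rule order_tendstoD) (use e \<alpha> in simp)
  from frequently_eventually_frequently[OF level this]
  obtain K B where K: "I K < ennreal (e * (\<alpha> / 2)\<^sup>2)" and B: "B \<in> fmeasurable lborel" "measure lborel B \<le> A"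
    and cover: "\<And>x. x \<in> {0..1} \<Longrightarrow> \<alpha> / 2 < cmod (f K x) \<Longrightarrow> x \<in> B"
    by (auto dest!: frequently_ex)
  \<comment> \<open>Normalises the Markov inequality to level 1, so that \<open>E\<close> is the set
    where the difference is at least \<open>\<alpha> / 2\<close>.\<close>
  define c where "c = 1 / (\<alpha> / 2)\<^sup>2"
  have c: "0 < c" using \<alpha> by (simp add: c_def)
  define E where "E = {x \<in> {0..1}. 1 \<le> ennreal c * ennreal ((cmod (f K x - m x))\<^sup>2)}"
  have "emeasure lborel E \<le> ennreal c * I K"
    unfolding E_def I_def by (rule nn_integral_Markov_inequality) simp_all
  also have "\<dots> \<le> ennreal c * ennreal (e * (\<alpha> / 2)\<^sup>2)"
    using K by (intro mult_left_mono) auto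
  also have "\<dots> = ennreal e" using \<alpha> e by (simp add: c_def flip: ennreal_mult)
  finally have Ee: "emeasure lborel E \<le> ennreal e" .
  have Em: "E \<in> sets lborel" unfolding E_def by measurable
  have Ef: "E \<in> fmeasurable lborel"
    by (rule fmeasurableI[OF Em]) (use Ee in \<open>auto intro: order.strict_trans1\<close>)
  have Emeas: "measure lborel E \<le> e"
    using Ee e by (simp add: measure_def enn2real_leI)
  have "{x \<in> {0..1}. cmod (m x) > \<alpha>} \<subseteq> B \<union> E"
  proof
    fix x assume x: "x \<in> {x \<in> {0..1}. cmod (m x) > \<alpha>}"
    show "x \<in> B \<union> E"
    proof (cases "\<alpha> / 2 < cmod (f K x)")
      case True
      then show ?thesis using cover x by auto
    next
      case False
      have "cmod (m x) \<le> cmod (f K x) + cmod (f K x - m x)" by (metis norm_minus_commute norm_triangle_sub add.commute)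
      then have "\<alpha> / 2 \<le> cmod (f K x - m x)" using False x by auto
      then have "(\<alpha> / 2)\<^sup>2 \<le> (cmod (f K x - m x))\<^sup>2" using \<alpha> by (intro power_mono) auto
      then have "1 \<le> c * (cmod (f K x - m x))\<^sup>2" using \<alpha> by (simp add: c_def field_simps)
      then have "1 \<le> ennreal c * ennreal ((cmod (f K x - m x))\<^sup>2)"
        using c by (simp flip: ennreal_mult)
      then show ?thesis using x by (simp add: E_def)
    qed
  qed
  then have "measure lborel {x \<in> {0..1}. cmod (m x) > \<alpha>} \<le> measure lborel (B \<union> E)"
    by (intro measure_mono_fmeasurable fmeasurable.Un B Ef) auto
  also have "\<dots> \<le> measure lborel B + measure lborel E"
    by (intro measure_Un_le) (use B Ef in auto)
  finally show "measure lborel {x \<in> {0..1}. cmod (m x) > \<alpha>} \<le> A + e" using B(2) Emeas by linarith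
qed

theorem theorem1:
  fixes N :: nat and chi :: "nat \<Rightarrow> complex" and s :: real and m :: "real \<Rightarrow> complex"
  assumes "N > 1"
    and "primitive_character N chi"
    and "1/2 < s" and "s < 1"
    and "m \<in> borel_measurable lborel"
    and "(\<lambda>K. \<integral>\<^sup>+ x. ennreal ((cmod (m_partial s chi K x - m x))\<^sup>2) * indicator {0..1} x \<partial>lborel)
           \<longlonglongrightarrow> 0"
  shows "\<exists>c::real. \<forall>\<alpha>::real. \<alpha> > 0 \<longrightarrow>
           measure lborel {x \<in> {0..1}. cmod (m x) > \<alpha>} \<le> c * \<alpha> powr (- 2 / (1 - s))"
proof -
  have N: "0 < N" and per: "\<And>n. chi (n + N) = chi n"
    using assms(1,2) by (auto simp: primitive_character_def dirichlet_character_def)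
  obtain C D :: real and J0 :: nat where C: "0 \<le> C" and D: "0 < D"
    and level: "\<And>J J'. J0 \<le> J \<Longrightarrow> J \<le> J' \<Longrightarrow> \<exists>B \<in> fmeasurable lborel. measure lborel B \<le> C * 2 powr (- 2 * real J) \<and>
        (\<forall>x\<in>{0..1}. D * 2 powr (real J * (1 - s)) < cmod (m_partial s chi (N * 2 ^ J' - 1) x) \<longrightarrow> x \<in> B)"
    by (rule m_partial_level_set[of chi N, OF per N assms(3,4)]) blast
  have meas: "m_partial s chi K \<in> borel_measurable lborel" for K
    unfolding m_partial_def[abs_def] by measurable
  define p where "p = 2 / (1 - s)"
  have p: "0 < p" "(1 - s) * p = 2" using assms(4) by (simp_all add: p_def divide_eq_eq)
  \<comment> \<open>Below \<open>\<alpha>0\<close> no admissible \<open>J\<close> need exist; there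
    the trivial bound by the length 1 of the interval is absorbed by the summand
    \<open>\<alpha>0 powr p\<close> of the constant.\<close>
  define \<alpha>0 where "\<alpha>0 = 2 * D * 2 powr (real J0 * (1 - s))"
  have "measure lborel {x \<in> {0..1}. cmod (m x) > \<alpha>} \<le> (\<alpha>0 powr p + C * (4 * D) powr p) * \<alpha> powr (- p)"
    if \<alpha>: "0 < \<alpha>" for \<alpha>
  proof (cases "\<alpha> \<le> \<alpha>0")
    case True
    have "measure lborel {x \<in> {0..1}. cmod (m x) > \<alpha>} \<le> measure lborel {0..1::real}"
      using assms(5) by (intro measure_mono_fmeasurable fmeasurable_compact) auto
    also have "\<dots> = \<alpha> powr p * \<alpha> powr (- p)" using \<alpha> by (simp flip: powr_add)
    also have "\<dots> \<le> \<alpha>0 powr p * \<alpha> powr (- p)"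
      using True \<alpha> p by (intro mult_right_mono powr_mono2) auto
    also have "\<dots> \<le> (\<alpha>0 powr p + C * (4 * D) powr p) * \<alpha> powr (- p)"
      using C by (intro mult_right_mono) auto
    finally show ?thesis .
  next
    case False
    \<comment> \<open>The real solution of \<open>D * 2 powr (u * (1 - s)) = \<alpha> / 2\<close>.
      Rounding it down gives the largest \<open>J\<close> whose level does not exceed
      \<open>\<alpha> / 2\<close>.\<close>
    define u where "u = log 2 (\<alpha> / (2 * D)) / (1 - s)"
    have u: "2 powr (u * (1 - s)) = \<alpha> / (2 * D)" using \<alpha> D assms(4) by (simp add: u_def)
    have "2 powr (real J0 * (1 - s)) < 2 powr (u * (1 - s))"
      using False D unfolding u \<alpha>0_def by (simp add: field_simps)
    then have "real J0 < u" using assms(4) by simp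
    define J where "J = nat \<lfloor>u\<rfloor>"
    have J: "J0 \<le> J" "real J \<le> u" "u < real J + 1"
      using \<open>real J0 < u\<close> unfolding J_def by linarith+
    have "2 powr (real J * (1 - s)) \<le> 2 powr (u * (1 - s))" using J assms(4) by simp
    then have le: "D * 2 powr (real J * (1 - s)) \<le> \<alpha> / 2" using D unfolding u by (simp add: field_simps)
    have "measure lborel {x \<in> {0..1}. cmod (m x) > \<alpha>} \<le> C * 2 powr (- 2 * real J)"
    proof (rule measure_le_of_L2_approx[OF meas assms(5,6) \<alpha>])
      show "\<exists>\<^sub>F K in sequentially. \<exists>B \<in> fmeasurable lborel. measure lborel B \<le> C * 2 powr (- 2 * real J) \<and>
        (\<forall>x\<in>{0..1}. \<alpha> / 2 < cmod (m_partial s chi K x) \<longrightarrow> x \<in> B)"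
        unfolding frequently_sequentially
      proof
        fix n
        \<comment> \<open>Any \<open>J' \<ge> J\<close> is allowed by the level set bound, and
          \<open>J' \<ge> n\<close> pushes the index \<open>N * 2 ^ J' - 1\<close> beyond
          \<open>n\<close>.\<close>
        define J' where "J' = max J n"
        have "n < 2 ^ n" by (rule less_exp)
        also have "(2::nat) ^ n \<le> 2 ^ J'" by (intro power_increasing) (auto simp: J'_def)
        also have "\<dots> \<le> N * 2 ^ J'" using N by simp
        finally have "n \<le> N * 2 ^ J' - 1" by simp
        moreover have "J \<le> J'" by (simp add: J'_def)
        note level[OF J(1) this]
        ultimately show "\<exists>K\<ge>n. \<exists>B \<in> fmeasurable lborel. measure lborel B \<le> C * 2 powr (- 2 * real J) \<and>
            (\<forall>x\<in>{0..1}. \<alpha> / 2 < cmod (m_partial s chi K x) \<longrightarrow> x \<in> B)"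
          using le by (meson order.strict_trans1)
      qed
    qed
    also have "2 powr (- 2 * real J) \<le> (4 * D) powr p * \<alpha> powr (- p)"
    proof -
      \<comment> \<open>Rounding \<open>u\<close> down loses at most the factor
        \<open>2 powr (1 - s) \<le> 2\<close>, which turns \<open>2 * D\<close> into
        \<open>4 * D\<close>. Raising to the power \<open>- p\<close> then produces
        \<open>2 powr (- 2 * J)\<close> because \<open>(1 - s) * p = 2\<close>.\<close>
      have "\<alpha> / (2 * D) \<le> 2 powr ((real J + 1) * (1 - s))"
        unfolding u[symmetric] using J assms(4) by simp
      also have "\<dots> = 2 powr (real J * (1 - s)) * 2 powr (1 - s)"
        by (simp add: algebra_simps flip: powr_add)
      also have "\<dots> \<le> 2 powr (real J * (1 - s)) * 2 powr 1"
        using assms(3) by (intro mult_left_mono powr_mono) auto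
      finally have "\<alpha> / (4 * D) \<le> 2 powr (real J * (1 - s))" using D by (simp add: field_simps)
      then have "(2 powr (real J * (1 - s))) powr (- p) \<le> (\<alpha> / (4 * D)) powr (- p)"
        using p \<alpha> D by (intro powr_mono2') auto
      moreover have "(2 powr (real J * (1 - s))) powr (- p) = 2 powr (- 2 * real J)"
      proof -
        have "real J * (1 - s) * (- p) = - (real J * ((1 - s) * p))" by simp
        then have "real J * (1 - s) * (- p) = - 2 * real J" unfolding p(2) by simp
        then show ?thesis by (simp only: powr_powr)
      qed
      moreover have "(\<alpha> / (4 * D)) powr (- p) = (4 * D) powr p * \<alpha> powr (- p)"
        using \<alpha> D by (simp add: powr_divide powr_minus field_simps)
      ultimately show ?thesis by simp
    qed
    also have "C * ((4 * D) powr p * \<alpha> powr (- p)) \<le> (\<alpha>0 powr p + C * (4 * D) powr p) * \<alpha> powr (- p)"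
      by (simp add: algebra_simps)
    finally show ?thesis using C by (simp add: mult_left_mono)
  qed
  then show ?thesis unfolding p_def by (intro exI[of _ "\<alpha>0 powr p + C * (4 * D) powr p"]) (auto simp: p_def)
qed

end
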